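(* Let $\lambda\le\kappa$ be infinite regular cardinals and let $\mathcal F$ be a $(\kappa,\lambda)$-matrix. Then the topological group $G(\mathcal F)$ has character $\kappa^+$.
   Context: Ordinals are identified with the set of smaller ordinals; $[X]^{<\omega}$ is the set of finite subsets of $X$; $\triangle$ is symmetric difference. The character of a topological group is the least cardinality of a local base at the identity. Let $\lambda\le\kappa$ be infinite regular cardinals and $C$ a cofinal subset of $\kappa^+$. A $(\kappa,\lambda)$-matrix (indexed by $C$) is a family $\mathcal F=\{F_\xi(\alpha):\alpha\in C,\ \xi<\lambda\}$ of sets such that: (G1) $\bigcup_{\xi<\lambda}F_\xi(\alpha)=\alpha$ for every $\alpha\in C$; (G2) $F_\xi(\alpha)\subseteq F_\eta(\alpha)$ for each $\alpha\in C$ and all $\xi\le\eta<\lambda$; (G3) for all $\alpha\le\beta$ in $C$ and each $\xi<\lambda$ there is $\eta<\lambda$ with $F_\xi(\alpha)\subseteq F_\eta(\beta)$. For $\xi<\lambda$ and $\alpha\in C$ put $U_\xi(\alpha)=\{a\in[\kappa^+]^{<\omega}: a\cap F_\xi(\alpha)=\emptyset\}$, and $\mathcal U(\mathcal F)=\{U_\xi(\alpha):\xi<\lambda,\ \alpha\in C\}$. $G(\mathcal F)$ denotes the topological group $([\kappa^+]^{<\omega},\triangle)$ with the group topology for which $\mathcal U(\mathcal F)$ is an open neighborhood base at the identity $\emptyset$. *)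

theory Defs
  imports "HOL-Analysis.Analysis" "HOL-Algebra.Group"
begin

unbundle cardinal_syntax

definition topological_group :: "('g, 'm) monoid_scheme \<Rightarrow> 'g topology \<Rightarrow> bool" where
  "topological_group G T \<longleftrightarrow>
     group G \<and> topspace T = carrier G \<and>
     continuous_map (prod_topology T T) T (\<lambda>(x, y). x \<otimes>\<^bsub>G\<^esub> y) \<and>
     continuous_map T T (\<lambda>x. inv\<^bsub>G\<^esub> x)"

definition local_base :: "'g topology \<Rightarrow> 'g \<Rightarrow> 'g set set \<Rightarrow> bool" where
  "local_base T x \<B> \<longleftrightarrow>
     (\<forall>V\<in>\<B>. openin T V \<and> x \<in> V) \<and>
     (\<forall>W. openin T W \<and> x \<in> W \<longrightarrow> (\<exists>V\<in>\<B>. V \<subseteq> W))"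

text \<open>Cardinals are represented by relations, up to the equivalence \<open>=o\<close>; the character is one
  representative of the least cardinality of a local base at the identity.\<close>

definition group_character :: "('g, 'm) monoid_scheme \<Rightarrow> 'g topology \<Rightarrow> 'g set rel" where
  "group_character G T =
     (SOME r. (\<exists>\<B>. local_base T \<one>\<^bsub>G\<^esub> \<B> \<and> r = |\<B>| ) \<and>
              (\<forall>\<B>. local_base T \<one>\<^bsub>G\<^esub> \<B> \<longrightarrow> r \<le>o |\<B>| ))"

lemma group_character_is_least:
  shows "\<exists>\<B>. local_base T \<one>\<^bsub>G\<^esub> \<B> \<and> group_character G T = |\<B>|"
    and "local_base T \<one>\<^bsub>G\<^esub> \<B> \<Longrightarrow> group_character G T \<le>o |\<B>|"
proof -
  let ?R = "{|\<B>| |\<B>. local_base T \<one>\<^bsub>G\<^esub> \<B>}"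
  have "local_base T \<one>\<^bsub>G\<^esub> {W. openin T W \<and> \<one>\<^bsub>G\<^esub> \<in> W}"
    unfolding local_base_def by auto
  then have "?R \<noteq> {}" by blast
  moreover have "\<forall>r\<in>?R. Card_order r" using card_of_Card_order by blast
  ultimately have "\<exists>r\<in>?R. \<forall>r'\<in>?R. r \<le>o r'"
    by (rule exists_minim_Card_order)
  then obtain \<A> where "local_base T \<one>\<^bsub>G\<^esub> \<A>" "\<forall>r'\<in>?R. |\<A>| \<le>o r'"
    by (elim bexE CollectE exE conjE) simp
  then have "\<exists>r. (\<exists>\<B>. local_base T \<one>\<^bsub>G\<^esub> \<B> \<and> r = |\<B>| ) \<and>
              (\<forall>\<B>. local_base T \<one>\<^bsub>G\<^esub> \<B> \<longrightarrow> r \<le>o |\<B>| )"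
    by (intro exI[of _ "|\<A>|"] conjI exI[of _ \<A>] allI impI) auto
  from someI_ex[OF this, folded group_character_def]
  show "\<exists>\<B>. local_base T \<one>\<^bsub>G\<^esub> \<B> \<and> group_character G T = |\<B>|"
    and "local_base T \<one>\<^bsub>G\<^esub> \<B> \<Longrightarrow> group_character G T \<le>o |\<B>|"
    by simp_all
qed

text \<open>The ordinals below a cardinal \<open>r\<close> are the elements of \<open>Field r\<close>, and an ordinal
  \<open>\<alpha>\<close> is the set \<open>underS r \<alpha>\<close> of smaller ones; \<open>\<kappa>\<^sup>+\<close> is \<open>cardSuc \<kappa>\<close>. The library's
  \<open>cofinal\<close> asks for strictly larger elements of \<open>C\<close>, which is no restriction in a
  limit ordinal, but it does not ask for \<open>C \<subseteq> Field (cardSuc \<kappa>)\<close>.\<close>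

definition is_matrix ::
    "'k rel \<Rightarrow> 'l rel \<Rightarrow> 'k set set \<Rightarrow> ('l \<Rightarrow> 'k set \<Rightarrow> 'k set set) \<Rightarrow> bool" where
  "is_matrix \<kappa> l C F \<longleftrightarrow>
     C \<subseteq> Field (cardSuc \<kappa>) \<and> cofinal C (cardSuc \<kappa>) \<and>
     (\<forall>\<alpha>\<in>C. (\<Union>\<xi>\<in>Field l. F \<xi> \<alpha>) = underS (cardSuc \<kappa>) \<alpha>) \<and>
     (\<forall>\<alpha>\<in>C. \<forall>\<xi> \<eta>. (\<xi>, \<eta>) \<in> l \<longrightarrow> F \<xi> \<alpha> \<subseteq> F \<eta> \<alpha>) \<and>
     (\<forall>\<alpha>\<in>C. \<forall>\<beta>\<in>C. (\<alpha>, \<beta>) \<in> cardSuc \<kappa> \<longrightarrow>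
        (\<forall>\<xi>\<in>Field l. \<exists>\<eta>\<in>Field l. F \<xi> \<alpha> \<subseteq> F \<eta> \<beta>))"

definition fin_group :: "'x set \<Rightarrow> 'x set monoid" where
  "fin_group X = \<lparr>carrier = Fpow X, mult = sym_diff, one = {}\<rparr>"

definition matrix_nbhd ::
    "'k rel \<Rightarrow> ('l \<Rightarrow> 'k set \<Rightarrow> 'k set set) \<Rightarrow> 'l \<Rightarrow> 'k set \<Rightarrow> 'k set set set" where
  "matrix_nbhd \<kappa> F \<xi> \<alpha> = {a \<in> Fpow (Field (cardSuc \<kappa>)). a \<inter> F \<xi> \<alpha> = {}}"

definition matrix_nbhds ::
    "'k rel \<Rightarrow> 'l rel \<Rightarrow> 'k set set \<Rightarrow> ('l \<Rightarrow> 'k set \<Rightarrow> 'k set set) \<Rightarrow> 'k set set set set" where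
  "matrix_nbhds \<kappa> l C F = {matrix_nbhd \<kappa> F \<xi> \<alpha> |\<xi> \<alpha>. \<xi> \<in> Field l \<and> \<alpha> \<in> C}"

abbreviation matrix_group :: "'k rel \<Rightarrow> 'k set set monoid" where
  "matrix_group \<kappa> \<equiv> fin_group (Field (cardSuc \<kappa>))"

text \<open>Existence and uniqueness of this topology are shown in \<open>matrix_topology_ex1\<close> below.\<close>

definition matrix_topology ::
    "'k rel \<Rightarrow> 'l rel \<Rightarrow> 'k set set \<Rightarrow> ('l \<Rightarrow> 'k set \<Rightarrow> 'k set set) \<Rightarrow> 'k set set topology" where
  "matrix_topology \<kappa> l C F =
     (THE T. topological_group (matrix_group \<kappa>) T \<and>
             local_base T \<one>\<^bsub>matrix_group \<kappa>\<^esub> (matrix_nbhds \<kappa> l C F))"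

lemma fin_group_simps [simp]:
  "carrier (fin_group X) = Fpow X" "mult (fin_group X) = sym_diff" "one (fin_group X) = {}"
  by (simp_all add: fin_group_def)

lemma sym_diff_Fpow [simp]: "a \<in> Fpow X \<Longrightarrow> b \<in> Fpow X \<Longrightarrow> sym_diff a b \<in> Fpow X"
  by (auto simp: Fpow_def)

lemma sym_diff_cancel: "sym_diff a (sym_diff a b) = b"
  by blast

lemma sym_diff_assoc: "sym_diff (sym_diff a b) c = sym_diff a (sym_diff b c)"
  by blast

lemma group_fin_group: "group (fin_group X)"
proof (rule groupI)
  fix x assume "x \<in> carrier (fin_group X)"
  then show "\<exists>y\<in>carrier (fin_group X). y \<otimes>\<^bsub>fin_group X\<^esub> x = \<one>\<^bsub>fin_group X\<^esub>"
    by (intro bexI[of _ x]) auto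
qed (simp_all add: sym_diff_assoc, simp add: Fpow_def)

lemma inv_fin_group: "x \<in> Fpow X \<Longrightarrow> inv\<^bsub>fin_group X\<^esub> x = x"
  by (rule group.inv_equality[OF group_fin_group]) auto

lemma fin_group_topology_ex1:
  fixes \<U> :: "'x set set set"
  assumes ne: "\<U> \<noteq> {}"
    and sub: "\<And>U. U \<in> \<U> \<Longrightarrow> U \<subseteq> Fpow X"
    and zero: "\<And>U. U \<in> \<U> \<Longrightarrow> {} \<in> U"
    and closed: "\<And>U a b. U \<in> \<U> \<Longrightarrow> a \<in> U \<Longrightarrow> b \<in> U \<Longrightarrow> sym_diff a b \<in> U"
    and dir: "\<And>U V. U \<in> \<U> \<Longrightarrow> V \<in> \<U> \<Longrightarrow> \<exists>W\<in>\<U>. W \<subseteq> U \<inter> V"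
  shows "\<exists>!T. topological_group (fin_group X) T \<and> local_base T \<one>\<^bsub>fin_group X\<^esub> \<U>"
proof -
  define d where "d = (sym_diff :: 'x set \<Rightarrow> 'x set \<Rightarrow> 'x set)"
  have fg: "mult (fin_group X) = d" by (simp add: d_def)
  have d_Fpow: "d a b \<in> Fpow X" if "a \<in> Fpow X" "b \<in> Fpow X" for a b
    using that unfolding d_def by (rule sym_diff_Fpow)
  have d_cancel: "d a (d a b) = b" for a b
    unfolding d_def by (rule sym_diff_cancel)
  have d_zero: "d {} b = b" "d a {} = a" for a b
    by (simp_all add: d_def)
  have d_assoc: "d (d a b) c = d a (d b c)" for a b c
    unfolding d_def by (rule sym_diff_assoc)
  have d_interchange: "d (d x u) (d y v) = d (d x y) (d u v)" for x u y v
    unfolding d_def by blast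
  have d_image: "d {} ` V = V" for V
    by (simp add: d_zero)
  have dclosed: "d a b \<in> U" if "U \<in> \<U>" "a \<in> U" "b \<in> U" for U a b
    using closed[OF that] by (simp add: d_def)
  define P where "P W \<longleftrightarrow> W \<subseteq> Fpow X \<and> (\<forall>a\<in>W. \<exists>U\<in>\<U>. d a ` U \<subseteq> W)" for W
  define T where "T = topology P"
  have PE: "\<exists>U\<in>\<U>. d a ` U \<subseteq> W" if "P W" "a \<in> W" for W a
    using that unfolding P_def by (elim conjE) (erule bspec)
  have "istopology P"
    unfolding istopology_def
  proof (intro conjI allI impI)
    fix S S' assume PS: "P S" "P S'"
    show "P (S \<inter> S')"
      unfolding P_def
    proof (intro conjI ballI)
      show "S \<inter> S' \<subseteq> Fpow X" using PS by (auto simp: P_def)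
      fix a assume "a \<in> S \<inter> S'"
      then have a: "a \<in> S" "a \<in> S'" by simp_all
      obtain U V where UV: "U \<in> \<U>" "V \<in> \<U>" "d a ` U \<subseteq> S" "d a ` V \<subseteq> S'"
        using PE[OF PS(1) a(1)] PE[OF PS(2) a(2)] by (elim bexE)
      from dir[OF UV(1,2)] obtain W where "W \<in> \<U>" "W \<subseteq> U \<inter> V" by blast
      from this(2) have "W \<subseteq> U" "W \<subseteq> V" by simp_all
      then have "d a ` W \<subseteq> S \<inter> S'"
        by (intro Int_greatest order_trans[OF image_mono UV(3)] order_trans[OF image_mono UV(4)])
      then show "\<exists>U\<in>\<U>. d a ` U \<subseteq> S \<inter> S'" using \<open>W \<in> \<U>\<close> by (rule bexI)
    qed
  next
    fix \<K> assume PK: "\<forall>K\<in>\<K>. P K"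
    show "P (\<Union>\<K>)"
      unfolding P_def
    proof (intro conjI ballI)
      show "\<Union>\<K> \<subseteq> Fpow X" using PK by (auto simp: P_def)
      fix a assume "a \<in> \<Union>\<K>"
      then obtain K where "K \<in> \<K>" "a \<in> K" by blast
      with PK PE[of K a] obtain U where U: "U \<in> \<U>" "d a ` U \<subseteq> K" by auto
      have "d a ` U \<subseteq> \<Union>\<K>" using U(2) Union_upper[OF \<open>K \<in> \<K>\<close>] by (rule order_trans)
      then show "\<exists>U\<in>\<U>. d a ` U \<subseteq> \<Union>\<K>" using U(1) by (rule bexI)
    qed
  qed
  then have op: "openin T W \<longleftrightarrow> P W" for W
    by (simp add: T_def topology_inverse')
  have "P (Fpow X)"
    unfolding P_def
  proof (intro conjI ballI)
    fix a assume a: "a \<in> Fpow X"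
    obtain U where "U \<in> \<U>" using ne by blast
    moreover from this have "d a ` U \<subseteq> Fpow X"
      using sub a by (intro image_subsetI d_Fpow) auto
    ultimately show "\<exists>U\<in>\<U>. d a ` U \<subseteq> Fpow X" by (intro bexI)
  qed simp
  then have top: "topspace T = Fpow X"
    unfolding topspace_def op by (auto simp: P_def)
  have coset: "P (d a ` U)" if "U \<in> \<U>" "a \<in> Fpow X" for a U
    unfolding P_def
  proof (intro conjI ballI)
    show "d a ` U \<subseteq> Fpow X" using that sub by (intro image_subsetI d_Fpow) auto
    fix b assume "b \<in> d a ` U"
    then obtain u where u: "u \<in> U" "b = d a u" by blast
    have "d b v \<in> d a ` U" if "v \<in> U" for v
    proof -
      have "d b v = d a (d u v)" using u(2) by (simp add: d_assoc)
      then show ?thesis using dclosed[OF \<open>U \<in> \<U>\<close> u(1) that] by blast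
    qed
    then show "\<exists>V\<in>\<U>. d b ` V \<subseteq> d a ` U" using that(1) by blast
  qed
  have cmult: "continuous_map (prod_topology T T) T (\<lambda>(x, y). d x y)"
    unfolding continuous_map_def
  proof (intro conjI allI impI)
    show "(\<lambda>(x, y). d x y) \<in> topspace (prod_topology T T) \<rightarrow> topspace T"
      by (auto simp only: topspace_prod_topology top Pi_iff split: prod.splits intro: d_Fpow)
    fix W assume W: "openin T W"
    show "openin (prod_topology T T)
      {z \<in> topspace (prod_topology T T). (case z of (x, y) \<Rightarrow> d x y) \<in> W}"
      unfolding openin_prod_topology_alt
    proof (intro allI impI)
      fix x y
      assume "(x, y) \<in> {z \<in> topspace (prod_topology T T). (case z of (x, y) \<Rightarrow> d x y) \<in> W}"
      then have xy: "x \<in> Fpow X" "y \<in> Fpow X" "d x y \<in> W" by (auto simp: top)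
      then obtain U where U: "U \<in> \<U>" "d (d x y) ` U \<subseteq> W"
        using W PE unfolding op by meson
      have "d x {} \<in> d x ` U" "d y {} \<in> d y ` U"
        using zero[OF U(1)] by blast+
      then have mem: "x \<in> d x ` U" "y \<in> d y ` U" by (simp_all only: d_zero)
      have sum: "d x' y' \<in> W" "x' \<in> Fpow X" "y' \<in> Fpow X"
        if x': "x' \<in> d x ` U" and y': "y' \<in> d y ` U" for x' y'
      proof -
        obtain u v where uv: "u \<in> U" "v \<in> U" "x' = d x u" "y' = d y v"
          using x' y' by blast
        have "d x' y' = d (d x y) (d u v)"
          using uv(3,4) by (simp add: d_interchange)
        then show "d x' y' \<in> W" using dclosed[OF U(1) uv(1,2)] U(2) by blast
        show "x' \<in> Fpow X" "y' \<in> Fpow X"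
          unfolding uv(3,4) using uv(1,2) sub[OF U(1)] xy(1,2) by (auto intro!: d_Fpow)
      qed
      have "d x ` U \<times> d y ` U \<subseteq>
          {z \<in> topspace (prod_topology T T). (case z of (x, y) \<Rightarrow> d x y) \<in> W}"
      proof (rule subsetI)
        fix z assume "z \<in> d x ` U \<times> d y ` U"
        then obtain x' y' where z: "z = (x', y')" "x' \<in> d x ` U" "y' \<in> d y ` U" by (elim SigmaE)
        from sum[OF z(2,3)]
        show "z \<in> {z \<in> topspace (prod_topology T T). (case z of (x, y) \<Rightarrow> d x y) \<in> W}"
          by (simp add: z(1) top)
      qed
      then show "\<exists>A B. openin T A \<and> openin T B \<and> x \<in> A \<and> y \<in> B \<and> A \<times> B \<subseteq>
          {z \<in> topspace (prod_topology T T). (case z of (x, y) \<Rightarrow> d x y) \<in> W}"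
        using coset[OF U(1) xy(1)] coset[OF U(1) xy(2)] mem unfolding op by blast
    qed
  qed
  have cinv: "continuous_map T T (\<lambda>x. inv\<^bsub>fin_group X\<^esub> x)"
    by (rule continuous_map_eq[OF continuous_map_id]) (simp add: top inv_fin_group)
  have tg: "topological_group (fin_group X) T"
    unfolding topological_group_def using cmult cinv unfolding fg by (simp add: group_fin_group top)
  have lb: "local_base T \<one>\<^bsub>fin_group X\<^esub> \<U>"
    unfolding local_base_def
  proof (intro conjI ballI allI impI)
    fix V assume V: "V \<in> \<U>"
    have "P (d {} ` V)" by (rule coset[OF V]) (simp add: Fpow_def)
    then show "openin T V" by (simp only: op d_image)
    show "\<one>\<^bsub>fin_group X\<^esub> \<in> V" using zero[OF V] by simp
  next
    fix W assume W: "openin T W \<and> \<one>\<^bsub>fin_group X\<^esub> \<in> W"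
    then obtain U where "U \<in> \<U>" "d {} ` U \<subseteq> W"
      using PE unfolding op fin_group_simps by meson
    then show "\<exists>V\<in>\<U>. V \<subseteq> W" unfolding d_image by blast
  qed
  have uniq: "T' = T"
    if tg': "topological_group (fin_group X) T'" and lb': "local_base T' \<one>\<^bsub>fin_group X\<^esub> \<U>" for T'
  proof -
    have top': "topspace T' = Fpow X"
      using tg' by (simp add: topological_group_def)
    have trans: "openin T' {x \<in> Fpow X. d a x \<in> W}" if "openin T' W" "a \<in> Fpow X" for a W
    proof -
      have c: "continuous_map T' (prod_topology T' T') (\<lambda>x. (a, x))"
        using that(2) by (simp add: continuous_map_pairwise o_def top')
      have "continuous_map (prod_topology T' T') T' (\<lambda>(x, y). d x y)"
        using tg' unfolding topological_group_def fg by blast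
      from continuous_map_compose[OF c this]
      have "continuous_map T' T' (\<lambda>x. d a x)" by (simp add: o_def)
      from openin_continuous_map_preimage[OF this that(1)]
      show ?thesis by (simp add: top')
    qed
    have "openin T' W \<longleftrightarrow> P W" for W
    proof
      assume W: "openin T' W"
      then have WX: "W \<subseteq> Fpow X" using openin_subset top' by blast
      show "P W"
        unfolding P_def
      proof (intro conjI ballI WX)
        fix a assume a: "a \<in> W"
        then have aX: "a \<in> Fpow X" using WX by blast
        have "{} \<in> {x \<in> Fpow X. d a x \<in> W}" using a by (simp add: Fpow_def d_zero)
        with trans[OF W aX] lb' obtain U where "U \<in> \<U>" "U \<subseteq> {x \<in> Fpow X. d a x \<in> W}"
          unfolding local_base_def fin_group_simps by meson
        then show "\<exists>U\<in>\<U>. d a ` U \<subseteq> W" by blast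
      qed
    next
      assume W: "P W"
      show "openin T' W"
      proof (subst openin_subopen, intro ballI)
        fix a assume a: "a \<in> W"
        then have aX: "a \<in> Fpow X" using W unfolding P_def by (elim conjE) (erule subsetD)
        obtain U where U: "U \<in> \<U>" "d a ` U \<subseteq> W" using PE[OF W a] by (elim bexE)
        let ?S = "{x \<in> Fpow X. d a x \<in> U}"
        have "openin T' U" using lb' U(1) by (simp add: local_base_def)
        then have "openin T' ?S" by (rule trans[OF _ aX])
        moreover have "a \<in> ?S" using aX zero[OF U(1)] d_cancel[of a "{}"] by (simp add: d_zero)
        moreover have "?S \<subseteq> W"
        proof
          fix x assume "x \<in> ?S"
          then have "d a (d a x) \<in> W" using U(2) by blast
          then show "x \<in> W" by (simp only: d_cancel)
        qed
        ultimately show "\<exists>S. openin T' S \<and> a \<in> S \<and> S \<subseteq> W" by blast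
      qed
    qed
    then show ?thesis by (simp add: topology_eq op)
  qed
  show ?thesis using tg lb uniq by blast
qed

lemma matrix_topology_ex1:
  assumes "Cinfinite \<kappa>" "Cinfinite l" and M: "is_matrix \<kappa> l C F"
  shows "\<exists>!T. topological_group (matrix_group \<kappa>) T \<and>
              local_base T \<one>\<^bsub>matrix_group \<kappa>\<^esub> (matrix_nbhds \<kappa> l C F)"
proof (rule fin_group_topology_ex1)
  let ?s = "cardSuc \<kappa>"
  have co: "Card_order ?s" using assms(1) by (simp add: cardSuc_Card_order)
  have wo_s: "Well_order ?s" using co by (simp add: card_order_on_def)
  have wo_l: "Well_order l" using assms(2) by (simp add: card_order_on_def)
  have tot: "(x, y) \<in> r \<or> (y, x) \<in> r"
    if "Well_order r" "x \<in> Field r" "y \<in> Field r" for r :: "'z rel" and x y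
    using that well_order_on_def[of "Field r" r] linear_order_on_def[of "Field r" r]
      partial_order_on_def[of "Field r" r] preorder_on_def[of "Field r" r]
    by (cases "x = y") (simp_all add: refl_on_def total_on_def)
  have FC: "C \<subseteq> Field ?s" "cofinal C ?s" using M by (auto simp: is_matrix_def)
  have "Field ?s \<noteq> {}"
    using assms(1) Cinfinite_cardSuc[of \<kappa>] unfolding cinfinite_def by force
  then have Cne: "C \<noteq> {}" using FC unfolding cofinal_def by blast
  have lne: "Field l \<noteq> {}" using assms(2) unfolding cinfinite_def by force
  show "matrix_nbhds \<kappa> l C F \<noteq> {}" using Cne lne unfolding matrix_nbhds_def by blast
  have mono: "F \<xi> \<alpha> \<subseteq> F \<eta> \<alpha>" if "\<alpha> \<in> C" "(\<xi>, \<eta>) \<in> l" for \<alpha> \<xi> \<eta>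
    using M that unfolding is_matrix_def by blast
  have amono: "\<exists>\<eta>\<in>Field l. F \<xi> \<alpha> \<subseteq> F \<eta> \<beta>"
    if "\<alpha> \<in> C" "\<beta> \<in> C" "(\<alpha>, \<beta>) \<in> ?s" "\<xi> \<in> Field l" for \<alpha> \<beta> \<xi>
    using M that unfolding is_matrix_def by blast
  have key: "\<exists>\<zeta>\<in>Field l. F \<xi> \<alpha> \<union> F \<eta> \<beta> \<subseteq> F \<zeta> \<beta>"
    if h: "\<alpha> \<in> C" "\<beta> \<in> C" "(\<alpha>, \<beta>) \<in> ?s" "\<xi> \<in> Field l" "\<eta> \<in> Field l" for \<alpha> \<beta> \<xi> \<eta>
  proof -
    obtain \<zeta> where z: "\<zeta> \<in> Field l" "F \<xi> \<alpha> \<subseteq> F \<zeta> \<beta>" using amono[OF h(1-4)] by blast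
    from tot[OF wo_l z(1) h(5)] show ?thesis
    proof
      assume "(\<zeta>, \<eta>) \<in> l"
      then show ?thesis using mono[OF h(2)] z h(5) by blast
    next
      assume "(\<eta>, \<zeta>) \<in> l"
      then show ?thesis using mono[OF h(2)] z by blast
    qed
  qed
  have dir: "\<exists>\<gamma>\<in>C. \<exists>\<zeta>\<in>Field l. F \<xi> \<alpha> \<union> F \<eta> \<beta> \<subseteq> F \<zeta> \<gamma>"
    if h: "\<alpha> \<in> C" "\<beta> \<in> C" "\<xi> \<in> Field l" "\<eta> \<in> Field l" for \<alpha> \<beta> \<xi> \<eta>
  proof -
    from h FC have "\<alpha> \<in> Field ?s" "\<beta> \<in> Field ?s" by auto
    from tot[OF wo_s this] show ?thesis
    proof
      assume "(\<alpha>, \<beta>) \<in> ?s"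
      from key[OF h(1,2) this h(3,4)] show ?thesis using h by blast
    next
      assume "(\<beta>, \<alpha>) \<in> ?s"
      from key[OF h(2,1) this h(4,3)] show ?thesis using h by blast
    qed
  qed
  fix U assume "U \<in> matrix_nbhds \<kappa> l C F"
  then obtain \<xi> \<alpha> where U: "U = matrix_nbhd \<kappa> F \<xi> \<alpha>" "\<xi> \<in> Field l" "\<alpha> \<in> C"
    unfolding matrix_nbhds_def by blast
  show "U \<subseteq> Fpow (Field ?s)" unfolding U matrix_nbhd_def by blast
  show "{} \<in> U" unfolding U matrix_nbhd_def by (auto simp: Fpow_def)
  show "sym_diff a b \<in> U" if "a \<in> U" "b \<in> U" for a b
    using that unfolding U matrix_nbhd_def by (auto intro: sym_diff_Fpow)
  show "\<exists>W\<in>matrix_nbhds \<kappa> l C F. W \<subseteq> U \<inter> V" if "V \<in> matrix_nbhds \<kappa> l C F" for V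
  proof -
    from that obtain \<eta> \<beta> where V: "V = matrix_nbhd \<kappa> F \<eta> \<beta>" "\<eta> \<in> Field l" "\<beta> \<in> C"
      unfolding matrix_nbhds_def by blast
    from dir[OF U(3) V(3) U(2) V(2)] obtain \<gamma> \<zeta>
      where g: "\<gamma> \<in> C" "\<zeta> \<in> Field l" "F \<xi> \<alpha> \<union> F \<eta> \<beta> \<subseteq> F \<zeta> \<gamma>" by blast
    have "matrix_nbhd \<kappa> F \<zeta> \<gamma> \<subseteq> U \<inter> V"
      using g(3) unfolding U V matrix_nbhd_def by blast
    moreover have "matrix_nbhd \<kappa> F \<zeta> \<gamma> \<in> matrix_nbhds \<kappa> l C F"
      using g unfolding matrix_nbhds_def by blast
    ultimately show ?thesis by blast
  qed
qed

lemma matrix_topology: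
  assumes "Cinfinite \<kappa>" "Cinfinite l" "is_matrix \<kappa> l C F"
  shows "topological_group (matrix_group \<kappa>) (matrix_topology \<kappa> l C F)"
    and "local_base (matrix_topology \<kappa> l C F) \<one>\<^bsub>matrix_group \<kappa>\<^esub> (matrix_nbhds \<kappa> l C F)"
  using theI'[OF matrix_topology_ex1[OF assms], folded matrix_topology_def] by blast+

end

theory Submission
  imports Defs
begin

text \<open>There are at most \<open>\<kappa>\<^sup>+\<close> basic neighborhoods. Conversely, refine a local base with fewer than
  \<open>\<kappa>\<^sup>+\<close> members to sets \<open>U\<^bsub>\<xi>\<^esub>(\<alpha>)\<close>. As \<open>\<kappa>\<^sup>+\<close> is regular, some \<open>\<gamma>\<close> lies below none of the \<open>\<alpha>\<close> that
  occur. But \<open>\<gamma> \<in> F\<^bsub>\<eta>\<^esub>(\<beta>)\<close> for some \<open>\<beta> \<in> C\<close> above \<open>\<gamma>\<close>, and a base member inside \<open>U\<^bsub>\<eta>\<^esub>(\<beta>)\<close> yields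
  \<open>F\<^bsub>\<eta>\<^esub>(\<beta>) \<subseteq> F\<^bsub>\<xi>\<^esub>(\<alpha>) \<subseteq> \<alpha>\<close>, hence \<open>\<gamma> < \<alpha>\<close>, for one of those \<open>\<alpha>\<close>.\<close>

text \<open>Singletons detect the inclusion: a point \<open>x\<close> of
  \<open>F \<eta> \<beta>\<close> missing from \<open>F \<xi> \<alpha>\<close> would put
  \<open>{x}\<close> into the smaller neighborhood but not into the larger one. The second
  assumption makes \<open>{x}\<close> an element of the group.\<close>

lemma matrix_nbhd_subset_imp_subset:
  assumes "matrix_nbhd \<kappa> F \<xi> \<alpha> \<subseteq> matrix_nbhd \<kappa> F \<eta> \<beta>" and "F \<eta> \<beta> \<subseteq> Field (cardSuc \<kappa>)"
  shows "F \<eta> \<beta> \<subseteq> F \<xi> \<alpha>"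
proof
  fix x assume x: "x \<in> F \<eta> \<beta>"
  then have "{x} \<notin> matrix_nbhd \<kappa> F \<eta> \<beta>"
    by (simp add: matrix_nbhd_def)
  then have "{x} \<notin> matrix_nbhd \<kappa> F \<xi> \<alpha>"
    using assms(1) by blast
  then show "x \<in> F \<xi> \<alpha>"
    using x assms(2) by (auto simp: matrix_nbhd_def Fpow_def)
qed

text \<open>The index set \<open>Field l \<times> C\<close> has both factors of size at most
  \<open>cardSuc \<kappa>\<close>, and an infinite cardinal absorbs products.\<close>

lemma card_matrix_nbhds_le:
  assumes \<kappa>: "Cinfinite \<kappa>" and l: "Card_order l" "l \<le>o \<kappa>" and C: "C \<subseteq> Field (cardSuc \<kappa>)"
  shows "|matrix_nbhds \<kappa> l C F| \<le>o cardSuc \<kappa>"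
proof -
  have s: "Cinfinite (cardSuc \<kappa>)" and co: "Card_order \<kappa>"
    using \<kappa> by (simp_all add: Cinfinite_cardSuc)
  have "matrix_nbhds \<kappa> l C F = (\<lambda>(\<xi>, \<alpha>). matrix_nbhd \<kappa> F \<xi> \<alpha>) ` (Field l \<times> C)"
    by (auto simp: matrix_nbhds_def)
  then have "|matrix_nbhds \<kappa> l C F| \<le>o |Field l \<times> C|"
    by (simp only: card_of_image)
  also have "|Field l \<times> C| \<le>o cardSuc \<kappa>"
  proof (rule card_of_Times_ordLeq_infinite_Field)
    show "\<not> finite (Field (cardSuc \<kappa>))" "Card_order (cardSuc \<kappa>)"
      using s by (simp_all add: cinfinite_def)
    have "|Field l| \<le>o l"
      by (rule ordIso_imp_ordLeq[OF card_of_Field_ordIso[OF l(1)]])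
    also note l(2)
    also have "\<kappa> \<le>o cardSuc \<kappa>"
      by (rule cardSuc_ordLeq[OF co])
    finally show "|Field l| \<le>o cardSuc \<kappa>" .
    have "|C| \<le>o |Field (cardSuc \<kappa>)|"
      by (rule card_of_mono1[OF C])
    then show "|C| \<le>o cardSuc \<kappa>"
      using card_of_Field_ordIso[OF cardSuc_Card_order[OF co]] by (rule ordLeq_ordIso_trans)
  qed
  finally show ?thesis .
qed

lemma cardSuc_le_local_base:
  assumes \<kappa>: "Cinfinite \<kappa>" and l: "Cinfinite l" and M: "is_matrix \<kappa> l C F"
    and \<B>: "local_base (matrix_topology \<kappa> l C F) {} \<B>"
  shows "cardSuc \<kappa> \<le>o |\<B>|"
proof (rule ccontr)
  let ?s = "cardSuc \<kappa>"
  assume "\<not> ?s \<le>o |\<B>|"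
  moreover have "Well_order ?s"
    using cardSuc_Card_order[of \<kappa>] \<kappa> by (simp add: card_order_on_def)
  ultimately have small: "|\<B>| <o ?s"
    using not_ordLeq_iff_ordLess[OF card_of_Well_order] by blast
  have C: "C \<subseteq> Field ?s" "cofinal C ?s"
    and G1: "\<And>\<alpha>. \<alpha> \<in> C \<Longrightarrow> (\<Union>\<xi>\<in>Field l. F \<xi> \<alpha>) = underS ?s \<alpha>"
    using M by (auto simp: is_matrix_def)
  have N: "local_base (matrix_topology \<kappa> l C F) {} (matrix_nbhds \<kappa> l C F)"
    using matrix_topology(2)[OF \<kappa> l M] by simp
  \<comment> \<open>Only \<open>\<alpha>\<close> will be chosen as a function of \<open>V\<close>:
    by (G1) it bounds \<open>F \<xi> \<alpha>\<close> for every \<open>\<xi>\<close>.\<close>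
  have "\<forall>V\<in>\<B>. \<exists>\<alpha>. \<alpha> \<in> C \<and> (\<exists>\<xi>\<in>Field l. matrix_nbhd \<kappa> F \<xi> \<alpha> \<subseteq> V)"
  proof
    fix V assume "V \<in> \<B>"
    then obtain U where "U \<in> matrix_nbhds \<kappa> l C F" "U \<subseteq> V"
      using \<B> N unfolding local_base_def by meson
    then show "\<exists>\<alpha>. \<alpha> \<in> C \<and> (\<exists>\<xi>\<in>Field l. matrix_nbhd \<kappa> F \<xi> \<alpha> \<subseteq> V)"
      by (auto simp: matrix_nbhds_def)
  qed
  from bchoice[OF this] obtain a
    where a: "\<forall>V\<in>\<B>. a V \<in> C \<and> (\<exists>\<xi>\<in>Field l. matrix_nbhd \<kappa> F \<xi> (a V) \<subseteq> V)" ..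
  have "|a ` \<B>| <o ?s"
    using card_of_image small by (rule ordLeq_ordLess_trans)
  then have "\<not> |a ` \<B>| =o ?s"
    by (rule not_ordLess_ordIso)
  moreover have "regularCard ?s"
    using \<kappa> by (simp add: regularCard_cardSuc)
  moreover have "a ` \<B> \<subseteq> Field ?s"
    using a C(1) by blast
  ultimately have "\<not> cofinal (a ` \<B>) ?s"
    unfolding regularCard_def by blast
  \<comment> \<open>As \<open>cofinal\<close> is strict, \<gamma> may equal some \<open>a V\<close>;
    the contradiction only needs that it is never strictly below one.\<close>
  then obtain \<gamma> where \<gamma>: "\<gamma> \<in> Field ?s" "\<And>V. V \<in> \<B> \<Longrightarrow> \<gamma> \<notin> underS ?s (a V)"
    unfolding cofinal_def underS_def by blast
  \<comment> \<open>Here strictness helps: \<beta> lies properly above \<gamma>, so (G1) at \<beta>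
    covers \<gamma>.\<close>
  obtain \<beta> where \<beta>: "\<beta> \<in> C" "\<gamma> \<in> underS ?s \<beta>"
    using C(2) \<gamma>(1) unfolding cofinal_def underS_def by blast
  then obtain \<eta> where \<eta>: "\<eta> \<in> Field l" "\<gamma> \<in> F \<eta> \<beta>"
    using G1 by blast
  then have "matrix_nbhd \<kappa> F \<eta> \<beta> \<in> matrix_nbhds \<kappa> l C F"
    using \<beta>(1) by (auto simp: matrix_nbhds_def)
  then obtain V where V: "V \<in> \<B>" "V \<subseteq> matrix_nbhd \<kappa> F \<eta> \<beta>"
    using \<B> N unfolding local_base_def by meson
  then obtain \<xi> where \<xi>: "\<xi> \<in> Field l" "matrix_nbhd \<kappa> F \<xi> (a V) \<subseteq> matrix_nbhd \<kappa> F \<eta> \<beta>"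
    using a by blast
  have "F \<eta> \<beta> \<subseteq> underS ?s \<beta>"
    unfolding G1[OF \<beta>(1), symmetric] using \<eta>(1) by (rule UN_upper)
  then have FF: "F \<eta> \<beta> \<subseteq> Field ?s"
    by (auto dest: underS_Field)
  have aC: "a V \<in> C"
    using a V(1) by blast
  have "F \<eta> \<beta> \<subseteq> F \<xi> (a V)"
    using \<xi>(2) FF by (rule matrix_nbhd_subset_imp_subset)
  moreover have "F \<xi> (a V) \<subseteq> underS ?s (a V)"
    unfolding G1[OF aC, symmetric] using \<xi>(1) by (rule UN_upper)
  ultimately show False
    using \<eta>(2) \<gamma>(2)[OF V(1)] by blast
qed

theorem theorem3p3:
  fixes \<kappa> :: "'k rel" and l :: "'l rel"
    and C :: "'k set set" and F :: "'l \<Rightarrow> 'k set \<Rightarrow> 'k set set"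
  assumes "Cinfinite \<kappa>" "regularCard \<kappa>"
    and "Cinfinite l" "regularCard l"
    and "l \<le>o \<kappa>"
    and "is_matrix \<kappa> l C F"
  shows "group_character (matrix_group \<kappa>) (matrix_topology \<kappa> l C F) =o cardSuc \<kappa>"
proof (rule ordIso_iff_ordLeq[THEN iffD2, OF conjI])
  let ?G = "matrix_group \<kappa>" and ?T = "matrix_topology \<kappa> l C F"
  have "group_character ?G ?T \<le>o |matrix_nbhds \<kappa> l C F|"
    by (rule group_character_is_least(2)[OF matrix_topology(2)[OF assms(1,3,6)]])
  also have "|matrix_nbhds \<kappa> l C F| \<le>o cardSuc \<kappa>"
    using assms by (intro card_matrix_nbhds_le) (auto simp: is_matrix_def)
  finally show "group_character ?G ?T \<le>o cardSuc \<kappa>" .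
  \<comment> \<open>The character is attained by an actual local base, so a lower bound valid for
    all local bases applies to it.\<close>
  obtain \<B> where "local_base ?T {} \<B>" "group_character ?G ?T = |\<B>|"
    using group_character_is_least(1)[of ?T ?G] by auto
  then show "cardSuc \<kappa> \<le>o group_character ?G ?T"
    using cardSuc_le_local_base[OF assms(1,3,6)] by simp
qed

end
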